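(* For every positive integer $m$ that is a multiple of $3$, the graph $R_m$ is perfect for the star-game with Minimizer responding (and Maximizer initiating).
   Context: Graphs are finite, simple and undirected. $P_3$ is the path on three vertices; copies of $P_3$ in a graph are subgraphs, not necessarily induced. $R_m$ (the rooks graph with two rows) is the graph obtained by taking two disjoint cliques of size $m$ and adding a perfect matching between them. The star-game on a graph $G$ is played by two players, Maximizer and Minimizer; throughout the game one of them is the initiator and the other is the responder. In each round, the initiator chooses a vertex $v$ of the current graph such that the current graph contains at least one copy of $P_3$ with $v$ as its center vertex (degree-2 vertex of the path); the responder then chooses one copy of $P_3$ in the current graph with $v$ as its center; the three vertices of that copy are removed, and the next round is played on the subgraph induced by the remaining vertices. The game ends when the remaining graph contains no copy of $P_3$. Maximizer tries to maximize, and Minimizer tries to minimize, the number of copies of $P_3$ taken. The value of the game is the number of copies taken under optimal play by both players. A graph is perfect (for a given version of the game) if under optimal play all vertices are taken, i.e. the value of the game equals $|V(G)|/3$. *)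

theory Defs
  imports "Graph_Theory.Graph_Theory"
begin

text \<open>
  Finite simple undirected graphs are the instances of the locale \<^locale>\<open>graph\<close>: an undirected
  edge is a pair of opposite arcs, and loops and parallel arcs are excluded.
\<close>

text \<open>
  As \<open>G\<close> is simple, a copy of the path on three vertices with a given center \<open>v\<close> is
  determined by its vertex set, so copies with center \<open>v\<close> are represented by their vertex sets.
  The two ends of the path may or may not be adjacent in \<open>G\<close>.
\<close>

definition star_copies :: "('a, 'b) pre_digraph \<Rightarrow> 'a \<Rightarrow> 'a set set" where
  "star_copies G v = {{u, v, w} | u w. u \<noteq> w \<and> v \<rightarrow>\<^bsub>G\<^esub> u \<and> v \<rightarrow>\<^bsub>G\<^esub> w}"

definition star_centers :: "('a, 'b) pre_digraph \<Rightarrow> 'a set" where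
  "star_centers G = {v \<in> verts G. star_copies G v \<noteq> {}}"

lemma star_copies_subset:
  assumes "wf_digraph G" "C \<in> star_copies G v"
  shows "v \<in> C" "C \<subseteq> verts G"
  using assms by (auto simp: star_copies_def dest: wf_digraph.adj_in_verts)

lemma graph_induce_subgraph:
  assumes "graph G" "S \<subseteq> verts G"
  shows "graph (G \<restriction> S)"
proof -
  interpret graph G by fact
  have ind: "induced_subgraph (G \<restriction> S) G"
    using assms(2) by (rule induced_induce)
  interpret D: digraph "G \<restriction> S"
    using ind by (rule digraphI_induced)
  interpret S: sym_digraph "G \<restriction> S"
    using ind by (rule induced_graph_imp_graph)
  show ?thesis by unfold_locales
qed

datatype player = Maximizer | Minimizer

fun opponent :: "player \<Rightarrow> player" where
  "opponent Maximizer = Minimizer"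
| "opponent Minimizer = Maximizer"

fun best :: "player \<Rightarrow> nat set \<Rightarrow> nat" where
  "best Maximizer X = Max X"
| "best Minimizer X = Min X"

text \<open>
  \<open>star_value i G\<close> is the number of copies taken under optimal play on \<open>G\<close> when \<open>i\<close> is the
  initiator; the responder is the other player. If \<open>G\<close> is not a finite simple graph,
  the value is a dummy.
\<close>

function star_value :: "player \<Rightarrow> ('a, 'b) pre_digraph \<Rightarrow> nat" where
  "star_value i G =
    (if graph G \<and> star_centers G \<noteq> {} then
       best i ((\<lambda>v.
         best (opponent i)
           ((\<lambda>C. Suc (star_value i (G \<restriction> (verts G - C)))) ` star_copies G v)) ` star_centers G)
     else 0)"
  by pat_completeness auto

termination
proof (relation "measure (\<lambda>(i, G). card (verts G))", goal_cases)
  case (2 i G v C)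
  then interpret graph G by simp
  have "C \<inter> verts G \<noteq> {}"
    using star_copies_subset[OF wf_digraph_axioms 2(3)] 2(2) by (auto simp: star_centers_def)
  then show ?case
    by (auto intro!: psubset_card_mono)
qed simp

declare star_value.simps [simp del]

lemma finite_star_centers: "graph G \<Longrightarrow> finite (star_centers G)"
  by (auto simp: star_centers_def graph_def digraph_def fin_digraph.finite_verts)

lemma finite_star_copies:
  assumes "graph G"
  shows "finite (star_copies G v)"
proof -
  interpret graph G by fact
  show ?thesis
    by (rule finite_subset[of _ "Pow (verts G)"])
      (blast dest: star_copies_subset(2)[OF wf_digraph_axioms], simp)
qed

definition star_perfect :: "player \<Rightarrow> ('a, 'b) pre_digraph \<Rightarrow> bool" where
  "star_perfect i G \<longleftrightarrow> real (star_value i G) = real (card (verts G)) / 3"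

text \<open>
  \<open>rooks_graph m G\<close> says that \<open>G\<close> is (a copy of) the rooks graph with two rows of size \<open>m\<close>;
  the bijection \<open>f\<close> gives the perfect matching between the two cliques.
\<close>

definition rooks_graph :: "nat \<Rightarrow> ('a, 'b) pre_digraph \<Rightarrow> bool" where
  "rooks_graph m G \<longleftrightarrow> graph G \<and>
    (\<exists>A B f. verts G = A \<union> B \<and> A \<inter> B = {} \<and>
       K\<^bsub>m\<^esub> (G \<restriction> A) \<and> K\<^bsub>m\<^esub> (G \<restriction> B) \<and>
       bij_betw f A B \<and> (\<forall>a\<in>A. \<forall>b\<in>B. a \<rightarrow>\<^bsub>G\<^esub> b \<longleftrightarrow> b = f a))"

lemma rooks_graph_exists:
  "\<exists>G :: (bool \<times> nat, (bool \<times> nat) \<times> (bool \<times> nat)) pre_digraph. rooks_graph m G"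
proof -
  define P where "P = \<lparr>pverts = (UNIV :: bool set) \<times> {..<m},
    parcs = {((r, i), (s, j)). i < m \<and> j < m \<and> (r = s \<longleftrightarrow> i \<noteq> j)}\<rparr>"
  have fin: "finite (parcs P)"
    by (rule finite_subset[of _ "(UNIV \<times> {..<m}) \<times> (UNIV \<times> {..<m})"]) (auto simp: P_def)
  interpret pair_graph P
    by unfold_locales (use fin in \<open>auto simp: P_def symmetric_def intro!: symI\<close>)
  let ?R = "\<lambda>r. {r} \<times> {..<m}"
  have complete: "K\<^bsub>m\<^esub> (with_proj P \<restriction> ?R r)" for r
  proof -
    have "graph (with_proj P \<restriction> ?R r)"
      using graph_induce_subgraph[OF pair_graphD_graph, of "?R r"] by (auto simp: P_def)
    then show ?thesis
      by (auto simp: complete_digraph_def arcs_ends_conv P_def)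
  qed
  have "rooks_graph m (with_proj P)"
    unfolding rooks_graph_def
  proof (intro conjI exI)
    show "graph (with_proj P)" by (rule pair_graphD_graph)
    show "verts (with_proj P) = ?R False \<union> ?R True" by (auto simp: P_def)
    show "bij_betw (\<lambda>(r, i). (\<not> r, i)) (?R False) (?R True)"
      by (auto simp: bij_betw_def inj_on_def image_iff)
    show "K\<^bsub>m\<^esub> (with_proj P \<restriction> ?R False)" "K\<^bsub>m\<^esub> (with_proj P \<restriction> ?R True)"
      by (rule complete)+
  qed (auto simp: P_def)
  then show ?thesis by blast
qed

end

theory Submission
  imports Defs
begin

text \<open>
  Every position of the game on a rooks graph consists of two disjoint cliques \<open>A\<close> and \<open>B\<close> joined
  by a partial matching (\<open>clique_pair\<close>). A copy with center \<open>v \<in> A\<close> is of one of two kinds: it lies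
  inside \<open>A\<close>, or it crosses, consisting of \<open>v\<close>, another vertex of \<open>A\<close> and the partner of \<open>v\<close>
  in \<open>B\<close>. The first kind preserves both clique sizes modulo 3, the second lowers them by 2 and 1.
  The Maximizer wins (all vertices are taken) from two kinds of positions.

  In a \<open>balanced\<close> position both sizes are divisible by 3. If some vertex has no partner, the
  Maximizer names it as the center; the responder cannot cross, so the position stays balanced.
  Otherwise the matching is perfect and the Maximizer names any vertex. If the responder crosses
  from \<open>A\<close>, the sizes become 1 and 2 modulo 3, and exactly one vertex of \<open>B\<close>, namely the partner
  of the second vertex taken from \<open>A\<close>, has lost its partner.

  In a \<open>skewed\<close> position the sizes of \<open>A\<close> and \<open>B\<close> are 1 and 2 modulo 3, and at most one vertex of
  \<open>B\<close> has no partner. So \<open>B\<close> has at least two vertices, hence a matched one, which the Maximizer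
  names. If the responder crosses, the position becomes balanced. If not, three vertices of
  \<open>B\<close> go and \<open>A\<close> is untouched: no vertex of \<open>B\<close> loses its partner and the position stays skewed.
  This cannot go on for ever: once \<open>B\<close> is down to two vertices, the responder has to cross.

  Thus every reply leads to a winning position with three vertices fewer
  (\<open>balanced_unmatched_residual\<close>, \<open>balanced_matched_residual\<close>, \<open>skewed_residual\<close>), and neither kind
  of position is stuck while vertices remain (\<open>balanced_center\<close>, \<open>skewed_matched_center\<close>).
  Induction on the number of vertices gives \<open>clique_pair_exhausted\<close>, and the rooks graph is balanced
  at the start.
\<close>

section \<open>Optimal play that exhausts a graph\<close>

lemma star_copiesI:
  "u \<noteq> w \<Longrightarrow> v \<rightarrow>\<^bsub>G\<^esub> u \<Longrightarrow> v \<rightarrow>\<^bsub>G\<^esub> w \<Longrightarrow> {u, v, w} \<in> star_copies G v"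
  by (auto simp: star_copies_def)

lemma (in digraph) star_copy_card:
  assumes "C \<in> star_copies G v"
  shows "card C = 3"
  using assms by (auto simp: star_copies_def card_insert_if dest: adj_not_same)

lemma best_in: "finite X \<Longrightarrow> X \<noteq> {} \<Longrightarrow> best i X \<in> X"
  by (cases i) auto

lemma card_star_residual:
  assumes "graph G" "C \<in> star_copies G v"
  shows "card (verts (G \<restriction> (verts G - C))) + 3 = card (verts G)"
proof -
  interpret graph G by fact
  have "C \<subseteq> verts G" "card C = 3"
    using star_copies_subset(2)[OF wf_digraph_axioms assms(2)] star_copy_card[OF assms(2)] by auto
  then show ?thesis
    using card_Diff_subset[of C "verts G"] card_mono[of "verts G" C] finite_subset[of C "verts G"]
    by simp
qed

lemma star_value_le: "3 * star_value i G \<le> card (verts G)"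
proof (induction i G rule: star_value.induct)
  case (1 i G)
  show ?case
  proof (cases "graph G \<and> star_centers G \<noteq> {}")
    case True
    let ?g = "\<lambda>C. Suc (star_value i (G \<restriction> (verts G - C)))"
    let ?h = "\<lambda>v. best (opponent i) (?g ` star_copies G v)"
    have "star_value i G = best i (?h ` star_centers G)"
      using True by (subst star_value.simps) simp
    also have "\<dots> \<in> ?h ` star_centers G"
      using True by (intro best_in) (auto simp: finite_star_centers)
    finally obtain v where v: "v \<in> star_centers G" "star_value i G = ?h v" by auto
    have "?h v \<in> ?g ` star_copies G v"
      using True v(1) by (intro best_in) (auto simp: finite_star_copies star_centers_def)
    then obtain C where "C \<in> star_copies G v" "star_value i G = ?g C" using v(2) by auto
    then show ?thesis
      using "1.IH"[OF True v(1), of C] card_star_residual[of G C v] True by simp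
  next
    case False
    then show ?thesis by (subst star_value.simps) (simp only: if_False)
  qed
qed

text \<open>
  The Maximizer's side of a strategy argument: one center after which every reply leaves an
  exhaustible position is enough. Taking such a center bounds the value from below; the matching
  upper bound is \<open>star_value_le\<close>, as each round uses up three vertices.
\<close>

lemma star_value_exhaustI:
  assumes "graph G" "v \<in> star_centers G"
    and exh: "\<And>C. C \<in> star_copies G v \<Longrightarrow>
      3 * star_value Maximizer (G \<restriction> (verts G - C)) = card (verts (G \<restriction> (verts G - C)))"
  shows "3 * star_value Maximizer G = card (verts G)"
proof -
  let ?g = "\<lambda>C. Suc (star_value Maximizer (G \<restriction> (verts G - C)))"
  let ?h = "\<lambda>v. Min (?g ` star_copies G v)"
  have "?h v \<in> ?g ` star_copies G v"
    using assms(1,2) by (intro Min_in) (auto simp: finite_star_copies star_centers_def)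
  then obtain C where C: "C \<in> star_copies G v" "?h v = ?g C" by auto
  have "star_value Maximizer G = Max (?h ` star_centers G)"
    using assms(1,2) by (subst star_value.simps) auto
  also have "\<dots> \<ge> ?h v"
    using assms(1,2) by (intro Max_ge) (auto simp: finite_star_centers)
  finally have "3 * ?g C \<le> 3 * star_value Maximizer G" using C(2) by simp
  then have "card (verts G) \<le> 3 * star_value Maximizer G"
    using exh[OF C(1)] card_star_residual[OF assms(1) C(1)] by simp
  then show ?thesis using star_value_le[of Maximizer G] by simp
qed

section \<open>Pairs of cliques joined by a partial matching\<close>

definition clique_pair :: "'a set \<Rightarrow> 'a set \<Rightarrow> ('a, 'b) pre_digraph \<Rightarrow> bool" where
  "clique_pair A B G \<longleftrightarrow> graph G \<and> verts G = A \<union> B \<and> A \<inter> B = {} \<and>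
     (\<forall>x\<in>A. \<forall>y\<in>A. x \<noteq> y \<longrightarrow> x \<rightarrow>\<^bsub>G\<^esub> y) \<and>
     (\<forall>x\<in>B. \<forall>y\<in>B. x \<noteq> y \<longrightarrow> x \<rightarrow>\<^bsub>G\<^esub> y) \<and>
     (\<forall>x\<in>A. \<forall>y\<in>B. \<forall>z\<in>B. x \<rightarrow>\<^bsub>G\<^esub> y \<longrightarrow> x \<rightarrow>\<^bsub>G\<^esub> z \<longrightarrow> y = z) \<and>
     (\<forall>x\<in>B. \<forall>y\<in>A. \<forall>z\<in>A. x \<rightarrow>\<^bsub>G\<^esub> y \<longrightarrow> x \<rightarrow>\<^bsub>G\<^esub> z \<longrightarrow> y = z)"

text \<open>
  Meant for a vertex \<open>x\<close> of one clique, with \<open>A\<close> being the other one.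
\<close>

definition unmatched :: "'a set \<Rightarrow> ('a, 'b) pre_digraph \<Rightarrow> 'a \<Rightarrow> bool" where
  "unmatched A G x \<longleftrightarrow> (\<forall>a\<in>A. \<not> x \<rightarrow>\<^bsub>G\<^esub> a)"

lemma clique_pair_swap: "clique_pair A B G \<Longrightarrow> clique_pair B A G"
  unfolding clique_pair_def by (elim conjE, intro conjI) (simp_all only: Un_commute Int_commute)

lemma clique_pairD:
  assumes "clique_pair A B G"
  shows "graph G" "verts G = A \<union> B" "A \<inter> B = {}"
  using assms by (simp_all add: clique_pair_def)

lemma clique_pair_adj:
  assumes "clique_pair A B G" "x \<in> A" "y \<in> A" "x \<noteq> y"
  shows "x \<rightarrow>\<^bsub>G\<^esub> y"
  using assms(1)[unfolded clique_pair_def] assms(2-) by simp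

lemma clique_pair_matching:
  assumes "clique_pair A B G" "x \<in> A" "y \<in> B" "z \<in> B" "x \<rightarrow>\<^bsub>G\<^esub> y" "x \<rightarrow>\<^bsub>G\<^esub> z"
  shows "y = z"
proof -
  have "\<forall>x\<in>A. \<forall>y\<in>B. \<forall>z\<in>B. x \<rightarrow>\<^bsub>G\<^esub> y \<longrightarrow> x \<rightarrow>\<^bsub>G\<^esub> z \<longrightarrow> y = z"
    using assms(1) unfolding clique_pair_def by (elim conjE)
  then show ?thesis using assms(2-) by blast
qed

lemma adj_induce_subgraph: "x \<rightarrow>\<^bsub>G \<restriction> S\<^esub> y \<longleftrightarrow> x \<rightarrow>\<^bsub>G\<^esub> y \<and> x \<in> S \<and> y \<in> S"
  by (auto simp: arcs_ends_conv)

lemma clique_pair_residual: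
  assumes "clique_pair A B G"
  shows "clique_pair (A - C) (B - C) (G \<restriction> (verts G - C))"
proof -
  have "graph (G \<restriction> (verts G - C))"
    using clique_pairD(1)[OF assms] by (intro graph_induce_subgraph) auto
  moreover have "A - C \<union> (B - C) = verts G - C" "(A - C) \<inter> (B - C) = {}"
    using clique_pairD(2,3)[OF assms] by blast+
  moreover have "\<forall>x\<in>A - C. \<forall>y\<in>B - C. \<forall>z\<in>B - C. x \<rightarrow>\<^bsub>G\<^esub> y \<longrightarrow> x \<rightarrow>\<^bsub>G\<^esub> z \<longrightarrow> y = z"
    using clique_pair_matching[OF assms] by blast
  moreover have "\<forall>x\<in>B - C. \<forall>y\<in>A - C. \<forall>z\<in>A - C. x \<rightarrow>\<^bsub>G\<^esub> y \<longrightarrow> x \<rightarrow>\<^bsub>G\<^esub> z \<longrightarrow> y = z"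
    using clique_pair_matching[OF clique_pair_swap[OF assms]] by blast
  ultimately show ?thesis
    using clique_pair_adj[OF assms] clique_pair_adj[OF clique_pair_swap[OF assms]]
      clique_pairD(2)[OF assms]
    unfolding clique_pair_def by (simp add: adj_induce_subgraph)
qed

lemma clique_pair_finite:
  assumes "clique_pair A B G"
  shows "finite A" "finite B"
proof -
  interpret graph G using assms by (simp add: clique_pairD)
  show "finite A" "finite B"
    using finite_verts clique_pairD(2)[OF assms] by simp_all
qed

lemma clique_pair_sym:
  assumes "clique_pair A B G" "x \<rightarrow>\<^bsub>G\<^esub> y"
  shows "y \<rightarrow>\<^bsub>G\<^esub> x"
proof -
  interpret graph G using assms by (simp add: clique_pairD)
  show ?thesis using assms(2) by (rule graph_symmetric)
qed

text \<open>
  A copy cannot have both ends in the other clique, since the center has at most one neighbour there.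
\<close>

lemma star_copy_cases:
  assumes cp: "clique_pair A B G" and v: "v \<in> A" and C: "C \<in> star_copies G v"
  obtains (side) "C \<subseteq> A" "card C = 3"
    | (cross) x y where "x \<in> A" "x \<noteq> v" "y \<in> B" "v \<rightarrow>\<^bsub>G\<^esub> y" "C = {v, x, y}"
proof -
  interpret graph G using cp by (rule clique_pairD)
  have V: "verts G = A \<union> B" using cp by (rule clique_pairD)
  have c3: "card C = 3" using C by (rule star_copy_card)
  obtain u w where uw: "C = {u, v, w}" "u \<noteq> w" "v \<rightarrow>\<^bsub>G\<^esub> u" "v \<rightarrow>\<^bsub>G\<^esub> w"
    using C by (auto simp: star_copies_def)
  have ne: "u \<noteq> v" "w \<noteq> v" and mem: "u \<in> A \<union> B" "w \<in> A \<union> B"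
    using uw(3,4) V adj_in_verts(2) by (auto dest: adj_not_same)
  have "\<not> (u \<in> B \<and> w \<in> B)" using clique_pair_matching[OF cp v] uw by blast
  then consider "u \<in> A" "w \<in> A" | "u \<in> A" "w \<in> B" | "u \<in> B" "w \<in> A" using mem by blast
  then show thesis
  proof cases
    case 1
    then show ?thesis using side c3 uw(1) v by simp
  next
    case 2
    then show ?thesis using cross[of u w] uw ne by (simp add: insert_commute)
  next
    case 3
    then show ?thesis using cross[of w u] uw ne by (simp add: insert_commute)
  qed
qed

lemma card_Diff_side:
  assumes cp: "clique_pair A B G" and "C \<subseteq> A" "card C = 3"
  shows "card (A - C) + 3 = card A" "B - C = B"
proof -
  have "finite A" using clique_pair_finite[OF cp] by simp
  then show "card (A - C) + 3 = card A"
    using assms card_Diff_subset[of C A] card_mono[of A C] finite_subset[of C A] by simp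
  show "B - C = B" using assms(2) clique_pairD(3)[OF cp] by blast
qed

lemma card_Diff_cross:
  assumes cp: "clique_pair A B G" and "v \<in> A" "x \<in> A" "x \<noteq> v" "y \<in> B" "C = {v, x, y}"
  shows "card (A - C) + 2 = card A" "card (B - C) + 1 = card B"
proof -
  have fin: "finite A" "finite B" using clique_pair_finite[OF cp] by simp_all
  have d: "A - C = A - {v, x}" "B - C = B - {y}" using assms(2-) clique_pairD(3)[OF cp] by auto
  have "card {v, x} = 2" "{v, x} \<subseteq> A" using assms by auto
  then show "card (A - C) + 2 = card A"
    unfolding d using card_Diff_subset[of "{v, x}" A] card_mono[of A "{v, x}"] fin by simp
  show "card (B - C) + 1 = card B"
    unfolding d using card_Suc_Diff1[OF fin(2) assms(5)] by simp
qed

lemma clique_star_center: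
  assumes cp: "clique_pair A B G" and "v \<in> A" "card A \<ge> 3"
  shows "v \<in> star_centers G"
proof -
  have "finite A" using clique_pair_finite[OF cp] by simp
  then have "card (A - {v}) \<ge> 2" using assms by simp
  then obtain T where "T \<subseteq> A - {v}" "card T = 2" by (rule obtain_subset_with_card_n)
  then obtain u w where "u \<in> A - {v}" "w \<in> A - {v}" "u \<noteq> w" by (auto simp: card_2_iff)
  then have "{u, v, w} \<in> star_copies G v"
    using clique_pair_adj[OF cp assms(2)] by (intro star_copiesI) auto
  then show ?thesis
    using clique_pairD(2)[OF cp] assms(2) by (auto simp: star_centers_def)
qed

section \<open>The strategy of the Maximizer\<close>

definition balanced :: "'a set \<Rightarrow> 'a set \<Rightarrow> ('a, 'b) pre_digraph \<Rightarrow> bool" where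
  "balanced A B G \<longleftrightarrow> clique_pair A B G \<and> 3 dvd card A \<and> 3 dvd card B"

text \<open>
  The roles of the two cliques differ: the Maximizer plays in the larger residue class \<open>B\<close>. Without
  the bound on unmatched vertices the position can be lost, as in two disjoint cliques of
  sizes 1 and 2.
\<close>

definition skewed :: "'a set \<Rightarrow> 'a set \<Rightarrow> ('a, 'b) pre_digraph \<Rightarrow> bool" where
  "skewed A B G \<longleftrightarrow> clique_pair A B G \<and> card A mod 3 = 1 \<and> card B mod 3 = 2 \<and>
     (\<forall>b\<in>B. \<forall>b'\<in>B. unmatched A G b \<longrightarrow> unmatched A G b' \<longrightarrow> b = b')"

lemma balanced_swap: "balanced A B G \<Longrightarrow> balanced B A G"
  using clique_pair_swap[of A B G] by (simp add: balanced_def)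

lemma balanced_side_residual:
  assumes "balanced A B G" "C \<subseteq> A" "card C = 3"
  shows "balanced (A - C) (B - C) (G \<restriction> (verts G - C))"
proof -
  have cp: "clique_pair A B G" using assms by (simp add: balanced_def)
  note c = card_Diff_side[OF cp assms(2,3)]
  have "3 dvd card (A - C) + 3" using assms(1) c(1) by (simp add: balanced_def)
  then have "3 dvd card (A - C)" by presburger
  then show ?thesis
    using assms(1) c(2) clique_pair_residual[OF cp, of C] by (simp add: balanced_def)
qed

lemma balanced_unmatched_residual:
  assumes "balanced A B G" "v \<in> A" "unmatched B G v" "C \<in> star_copies G v"
  shows "balanced (A - C) (B - C) (G \<restriction> (verts G - C))"
proof -
  have cp: "clique_pair A B G" using assms by (simp add: balanced_def)
  show ?thesis using cp assms(2,4)
  proof (cases rule: star_copy_cases)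
    case side
    then show ?thesis using balanced_side_residual[OF assms(1)] by blast
  next
    case cross
    then show ?thesis using assms(3) by (auto simp: unmatched_def)
  qed
qed

text \<open>
  If the responder crosses, a vertex that becomes unmatched in \<open>B\<close> was the partner of one of the two
  vertices taken from \<open>A\<close>. The partner of the center is taken as well, so only the partner of the
  other one is left; this gives the uniqueness that a skewed position requires.
\<close>

lemma balanced_matched_residual:
  assumes bal: "balanced A B G" and v: "v \<in> A" and C: "C \<in> star_copies G v"
    and all: "\<And>b. b \<in> B \<Longrightarrow> \<not> unmatched A G b"
  shows "balanced (A - C) (B - C) (G \<restriction> (verts G - C)) \<or>
    skewed (A - C) (B - C) (G \<restriction> (verts G - C))"
proof -
  have cp: "clique_pair A B G" using bal by (simp add: balanced_def)
  show ?thesis using cp v C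
  proof (cases rule: star_copy_cases)
    case side
    then show ?thesis using balanced_side_residual[OF bal] by blast
  next
    case (cross x y)
    let ?H = "G \<restriction> (verts G - C)"
    note c = card_Diff_cross[OF cp v cross(1-3,5)]
    have "3 dvd card (A - C) + 2" "3 dvd card (B - C) + 1"
      using bal c by (auto simp: balanced_def)
    then have m: "card (A - C) mod 3 = 1" "card (B - C) mod 3 = 2" by presburger+
    \<comment> \<open>A vertex that has just become unmatched is the partner of \<open>x\<close>.\<close>
    have lost: "x \<rightarrow>\<^bsub>G\<^esub> b" if b: "b \<in> B - C" and un: "unmatched (A - C) ?H b" for b
    proof -
      obtain a where a: "a \<in> A" "b \<rightarrow>\<^bsub>G\<^esub> a" using all[of b] b by (auto simp: unmatched_def)
      have V: "verts G = A \<union> B" using cp by (rule clique_pairD)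
      have "a \<in> C"
        using un a b V by (auto simp: unmatched_def adj_induce_subgraph)
      moreover have "a \<noteq> y" using a(1) cross(3) clique_pairD(3)[OF cp] by blast
      moreover have "a \<noteq> v"
      proof
        assume "a = v"
        then have "v \<rightarrow>\<^bsub>G\<^esub> b" using clique_pair_sym[OF cp a(2)] by simp
        then have "b = y" using clique_pair_matching[OF cp v] b cross(3,4) by blast
        then show False using b cross(5) by simp
      qed
      ultimately have "a = x" using cross(5) by simp
      then show ?thesis using clique_pair_sym[OF cp a(2)] by simp
    qed
    have "b = b'" if "b \<in> B - C" "b' \<in> B - C" "unmatched (A - C) ?H b" "unmatched (A - C) ?H b'"
      for b b'
      using clique_pair_matching[OF cp cross(1) _ _ lost[OF that(1,3)] lost[OF that(2,4)]] that(1,2)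
      by simp
    then have "skewed (A - C) (B - C) ?H"
      using m clique_pair_residual[OF cp, of C] unfolding skewed_def by blast
    then show ?thesis ..
  qed
qed

text \<open>
  A copy inside \<open>B\<close> leaves \<open>A\<close>, and with it all partners of vertices of \<open>B\<close>, untouched; a crossing
  copy takes 2 from \<open>B\<close> and 1 from \<open>A\<close>, which makes both sizes divisible by 3.
\<close>

lemma skewed_residual:
  assumes sk: "skewed A B G" and v: "v \<in> B" and C: "C \<in> star_copies G v"
  shows "balanced (A - C) (B - C) (G \<restriction> (verts G - C)) \<or>
    skewed (A - C) (B - C) (G \<restriction> (verts G - C))"
proof -
  have cp: "clique_pair A B G" using sk by (simp add: skewed_def)
  note cp' = clique_pair_swap[OF cp]
  let ?H = "G \<restriction> (verts G - C)"
  note res = clique_pair_residual[OF cp, of C]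
  show ?thesis using cp' v C
  proof (cases rule: star_copy_cases)
    case side
    note c = card_Diff_side[OF cp' side]
    have "(card (B - C) + 3) mod 3 = 2" using sk unfolding c(1) by (simp add: skewed_def)
    then have m: "card (B - C) mod 3 = 2" by simp
    have V: "verts G = A \<union> B" using cp by (rule clique_pairD)
    have "unmatched A G b" if "b \<in> B - C" "unmatched (A - C) ?H b" for b
      using that c(2) V by (auto simp: unmatched_def adj_induce_subgraph)
    then have "skewed (A - C) (B - C) ?H"
      using sk res m c(2) unfolding skewed_def by auto
    then show ?thesis ..
  next
    case (cross x y)
    note c = card_Diff_cross[OF cp' v cross(1-3,5)]
    have "(card (B - C) + 2) mod 3 = 2" "(card (A - C) + 1) mod 3 = 1"
      using sk unfolding c by (auto simp: skewed_def)
    then have "3 dvd card (B - C)" "3 dvd card (A - C)" by presburger+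
    then show ?thesis using res by (simp add: balanced_def)
  qed
qed

text \<open>
  One of any two vertices of \<open>B\<close> has a partner and so is the center of a crossing copy. This also
  covers the case of only two vertices in \<open>B\<close>, where there is no copy inside \<open>B\<close>.
\<close>

lemma skewed_matched_center:
  assumes sk: "skewed A B G"
  shows "\<exists>v\<in>B. v \<in> star_centers G"
proof -
  have cp: "clique_pair A B G" using sk by (simp add: skewed_def)
  have "card B \<ge> 2" using sk by (auto simp: skewed_def)
  then obtain T where "T \<subseteq> B" "card T = 2" by (rule obtain_subset_with_card_n)
  then obtain b b' where b: "b \<in> B" "b' \<in> B" "b \<noteq> b'" by (auto simp: card_2_iff)
  then have "\<not> unmatched A G b \<or> \<not> unmatched A G b'" using sk unfolding skewed_def by blast
  then obtain v w a where "v \<in> B" "w \<in> B" "v \<noteq> w" "a \<in> A" "v \<rightarrow>\<^bsub>G\<^esub> a"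
    unfolding unmatched_def using b by metis
  then have "{a, v, w} \<in> star_copies G v" "v \<in> verts G"
    using clique_pair_adj[OF clique_pair_swap[OF cp]] clique_pairD(2,3)[OF cp]
    by (auto intro!: star_copiesI)
  then show ?thesis
    using \<open>v \<in> B\<close> by (auto simp: star_centers_def)
qed

lemma balanced_center:
  assumes bal: "balanced A B G" and "v \<in> A"
  shows "v \<in> star_centers G"
proof -
  have cp: "clique_pair A B G" using bal by (simp add: balanced_def)
  have "finite A" using clique_pair_finite[OF cp] by simp
  then have "card A > 0" using assms(2) by (auto simp: card_gt_0_iff)
  then have "card A \<ge> 3" using bal by (auto simp: balanced_def dest: dvd_imp_le)
  then show ?thesis by (rule clique_star_center[OF cp assms(2)])
qed

lemma clique_pair_exhausted:
  assumes "balanced A B G \<or> skewed A B G"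
  shows "3 * star_value Maximizer G = card (verts G)"
  using assms
proof (induction "card (verts G)" arbitrary: A B G rule: less_induct)
  case less
  have cp: "clique_pair A B G" using less.prems by (auto simp: balanced_def skewed_def)
  note G = clique_pairD(1)[OF cp] and V = clique_pairD(2)[OF cp]
  have play: ?case
    if "v \<in> star_centers G"
      and "\<And>C. C \<in> star_copies G v \<Longrightarrow> \<exists>A' B'. balanced A' B' (G \<restriction> (verts G - C)) \<or>
        skewed A' B' (G \<restriction> (verts G - C))" for v
  proof (rule star_value_exhaustI[OF G that(1)])
    fix C assume C: "C \<in> star_copies G v"
    have "card (verts (G \<restriction> (verts G - C))) < card (verts G)"
      using card_star_residual[OF G C] by simp
    then show "3 * star_value Maximizer (G \<restriction> (verts G - C)) = card (verts (G \<restriction> (verts G - C)))"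
      using that(2)[OF C] less.hyps by blast
  qed
  \<comment> \<open>Stated for \<open>P\<close> and \<open>Q\<close>, so that the center may be in either of the two cliques.\<close>
  have bal_case: ?case if bal: "balanced P Q G" and v: "v \<in> P"
    and ch: "unmatched Q G v \<or> (\<forall>b\<in>Q. \<not> unmatched P G b)" for P Q v
  proof (rule play[OF balanced_center[OF bal v]])
    fix C assume "C \<in> star_copies G v"
    then show "\<exists>A' B'. balanced A' B' (G \<restriction> (verts G - C)) \<or> skewed A' B' (G \<restriction> (verts G - C))"
      using ch balanced_unmatched_residual[OF bal v] balanced_matched_residual[OF bal v] by blast
  qed
  from less.prems show ?case
  proof
    assume bal: "balanced A B G"
    consider "verts G = {}" | v where "v \<in> A" "unmatched B G v"
      | v where "v \<in> B" "unmatched A G v"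
      | v where "v \<in> A \<union> B" "\<forall>b\<in>B. \<not> unmatched A G b" "\<forall>a\<in>A. \<not> unmatched B G a"
      using V by blast
    then show ?case
    proof cases
      case 1
      then show ?thesis using star_value_le[of Maximizer G] by simp
    next
      case 4
      then show ?thesis using bal_case[OF bal] bal_case[OF balanced_swap[OF bal]] by blast
    qed (use bal_case[OF bal] bal_case[OF balanced_swap[OF bal]] in blast)+
  next
    assume sk: "skewed A B G"
    then obtain v where v: "v \<in> B" "v \<in> star_centers G" using skewed_matched_center by blast
    show ?case using play[OF v(2)] skewed_residual[OF sk v(1)] by blast
  qed
qed

lemma rooks_graph_balanced:
  assumes "3 dvd m" "rooks_graph m G"
  obtains A B where "balanced A B G"
proof -
  obtain A B f where G: "graph G" and V: "verts G = A \<union> B" "A \<inter> B = {}"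
    and K: "K\<^bsub>m\<^esub> (G \<restriction> A)" "K\<^bsub>m\<^esub> (G \<restriction> B)"
    and f: "bij_betw f A B" "\<forall>a\<in>A. \<forall>b\<in>B. a \<rightarrow>\<^bsub>G\<^esub> b \<longleftrightarrow> b = f a"
    using assms(2) unfolding rooks_graph_def by blast
  interpret graph G by (rule G)
  have "card S = m \<and> (\<forall>x\<in>S. \<forall>y\<in>S. x \<noteq> y \<longrightarrow> x \<rightarrow>\<^bsub>G\<^esub> y)" if S: "K\<^bsub>m\<^esub> (G \<restriction> S)" for S
  proof -
    have "x \<rightarrow>\<^bsub>G \<restriction> S\<^esub> y" if "x \<in> S" "y \<in> S" "x \<noteq> y" for x y
      using S that unfolding complete_digraph_def by auto
    then show ?thesis using S unfolding adj_induce_subgraph complete_digraph_def by auto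
  qed
  then have K': "card A = m" "card B = m"
    "\<forall>x\<in>A. \<forall>y\<in>A. x \<noteq> y \<longrightarrow> x \<rightarrow>\<^bsub>G\<^esub> y" "\<forall>x\<in>B. \<forall>y\<in>B. x \<noteq> y \<longrightarrow> x \<rightarrow>\<^bsub>G\<^esub> y"
    using K by blast+
  have "\<forall>x\<in>B. \<forall>y\<in>A. \<forall>z\<in>A. x \<rightarrow>\<^bsub>G\<^esub> y \<longrightarrow> x \<rightarrow>\<^bsub>G\<^esub> z \<longrightarrow> y = z"
    using f graph_symmetric unfolding bij_betw_def inj_on_def by metis
  then have "clique_pair A B G"
    using G V K'(3,4) f(2) unfolding clique_pair_def by simp
  then show thesis using that[of A B] assms(1) K'(1,2) by (simp add: balanced_def)
qed

theorem theorem17: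
  fixes m :: nat and G :: "('a, 'b) pre_digraph"
  assumes "m > 0" and "3 dvd m"
    and "rooks_graph m G"
  shows "star_perfect Maximizer G"
proof -
  obtain A B where "balanced A B G" using rooks_graph_balanced assms(2,3) by blast
  then have "3 * star_value Maximizer G = card (verts G)" using clique_pair_exhausted by blast
  then have "3 * real (star_value Maximizer G) = real (card (verts G))" by linarith
  then show ?thesis unfolding star_perfect_def by simp
qed

end
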